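(* Let $\Sigma$ be a finite alphabet and let $d_G$ be either the Besicovitch pseudometric $d_B$ or the Weyl pseudometric $d_W$ on $\Sigma^{\mathbb{Z}}$. Let $X\subset\Sigma^{\mathbb{Z}}$ be a nonempty subshift with the unique approximation property (with respect to $d_G$), and assume that $\tilde X$ consists of at least two $\sim$-classes. Then $X = \Sigma^{\mathbb{Z}}$.
   Context: For words $u,v$ of equal length, $H(u,v)$ is the Hamming distance. On $\Sigma^{\mathbb{Z}}$, $d_B(x,y)=\limsup_{n\to\infty}\frac{H(x_{[-n,n]},y_{[-n,n]})}{2n+1}$ and $d_W(x,y)=\limsup_{n\to\infty}\max_{m\in\mathbb{Z}}\frac{H(x_{[m-n,m+n]},y_{[m-n,m+n]})}{2n+1}$. Write $x\sim y$ if $d_G(x,y)=0$; $\tilde X=\{y\in\Sigma^{\mathbb{Z}} : \exists x\in X,\ x\sim y\}$. A subshift is a subset of $\Sigma^{\mathbb{Z}}$ closed in the product topology and invariant under the shift. A set $X\subset\Sigma^{\mathbb{Z}}$ has the unique approximation property if for every $y\in\Sigma^{\mathbb{Z}}$ the set $\{x\in X : d_G(y,x)=d_G(y,X)\}$ is nonempty and all its elements are $\sim$-equivalent, where $d_G(y,X)=\inf_{x\in X}d_G(y,x)$. *)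

theory Defs
  imports "HOL-Analysis.Analysis"
begin

definition hamming :: "'a list \<Rightarrow> 'a list \<Rightarrow> nat" where
  "hamming u v = card {i. i < length u \<and> u ! i \<noteq> v ! i}"

definition window :: "(int \<Rightarrow> 'a) \<Rightarrow> int \<Rightarrow> int \<Rightarrow> 'a list" where
  "window x a b = map x [a..b]"

text \<open>
  The two pseudometrics take values in \<open>ereal\<close> so that \<open>limsup\<close> and the infimum over a set are
  the ones of a complete lattice; all the quotients lie between 0 and 1.
  The maximum over all window positions is taken over a finite set of values, see
  \<open>finite_range_window_density\<close> below.
\<close>

definition besicovitch :: "(int \<Rightarrow> 'a) \<Rightarrow> (int \<Rightarrow> 'a) \<Rightarrow> ereal" where
  "besicovitch x y =
     limsup (\<lambda>n::nat. ereal
       (real (hamming (window x (- int n) (int n)) (window y (- int n) (int n)))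
         / real (2 * n + 1)))"

definition weyl :: "(int \<Rightarrow> 'a) \<Rightarrow> (int \<Rightarrow> 'a) \<Rightarrow> ereal" where
  "weyl x y =
     limsup (\<lambda>n::nat. ereal
       (MAX m::int.
         real (hamming (window x (m - int n) (m + int n)) (window y (m - int n) (m + int n)))
           / real (2 * n + 1)))"

definition shift :: "(int \<Rightarrow> 'a) \<Rightarrow> int \<Rightarrow> 'a" where
  "shift x = (\<lambda>i. x (i + 1))"

definition full_shift_topology :: "(int \<Rightarrow> 'a) topology" where
  "full_shift_topology = product_topology (\<lambda>_. discrete_topology UNIV) UNIV"

definition subshift :: "(int \<Rightarrow> 'a) set \<Rightarrow> bool" where
  "subshift X \<longleftrightarrow> closedin full_shift_topology X \<and> shift ` X = X"

definition null_rel :: "('b \<Rightarrow> 'b \<Rightarrow> ereal) \<Rightarrow> ('b \<times> 'b) set" where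
  "null_rel d = {(x, y). d x y = 0}"

definition saturation :: "('b \<Rightarrow> 'b \<Rightarrow> ereal) \<Rightarrow> 'b set \<Rightarrow> 'b set" where
  "saturation d X = {y. \<exists>x\<in>X. (x, y) \<in> null_rel d}"

definition dist_to_set :: "('b \<Rightarrow> 'b \<Rightarrow> ereal) \<Rightarrow> 'b \<Rightarrow> 'b set \<Rightarrow> ereal" where
  "dist_to_set d y X = (INF x\<in>X. d y x)"

definition best_approx :: "('b \<Rightarrow> 'b \<Rightarrow> ereal) \<Rightarrow> 'b \<Rightarrow> 'b set \<Rightarrow> 'b set" where
  "best_approx d y X = {x \<in> X. d y x = dist_to_set d y X}"

definition unique_approximation_property :: "('b \<Rightarrow> 'b \<Rightarrow> ereal) \<Rightarrow> 'b set \<Rightarrow> bool" where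
  "unique_approximation_property d X \<longleftrightarrow>
     (\<forall>y. best_approx d y X \<noteq> {} \<and>
          (\<forall>a\<in>best_approx d y X. \<forall>b\<in>best_approx d y X. (a, b) \<in> null_rel d))"

lemma hamming_le_length: "hamming u v \<le> length u"
proof -
  have "card {i. i < length u \<and> u ! i \<noteq> v ! i} \<le> card {..<length u}"
    by (rule card_mono) auto
  then show ?thesis
    by (simp add: hamming_def)
qed

lemma finite_range_window_density:
  "finite (range (\<lambda>m::int.
     real (hamming (window x (m - int n) (m + int n)) (window y (m - int n) (m + int n)))
       / real (2 * n + 1)))"
proof (rule finite_subset)
  show "range (\<lambda>m::int.
     real (hamming (window x (m - int n) (m + int n)) (window y (m - int n) (m + int n)))
       / real (2 * n + 1)) \<subseteq> (\<lambda>k::nat. real k / real (2 * n + 1)) ` {..2 * n + 1}"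
  proof clarify
    fix m :: int
    let ?h = "hamming (window x (m - int n) (m + int n)) (window y (m - int n) (m + int n))"
    have "length (window x (m - int n) (m + int n)) = 2 * n + 1"
      by (simp add: window_def nat_add_distrib)
    then have "?h \<in> {..2 * n + 1}"
      by (metis atMost_iff hamming_le_length)
    then show "real ?h / real (2 * n + 1) \<in> (\<lambda>k::nat. real k / real (2 * n + 1)) ` {..2 * n + 1}"
      by blast
  qed
qed simp

end

theory Submission
  imports Defs
begin

text \<open>
  Let \<open>z\<close> have period \<open>N\<close>, and let \<open>x\<close> be a best approximation of \<open>z\<close> in \<open>X\<close>. Translating \<open>x\<close> by
  \<open>N\<close> gives another best approximation, so by uniqueness \<open>x\<close> is \<open>N\<close>-periodic up to density zero. If
  \<open>z \<notin> X\<close>, then by compactness \<open>x\<close> cannot agree with \<open>z\<close> on a long interval, so up to density zero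
  it has an error in every interval of length \<open>N\<close>: the distance from \<open>z\<close> to \<open>X\<close> is at least \<open>1/N\<close>.

  For \<open>N = 1\<close> this is the largest possible distance, so if a constant \<open>z\<close> were not in \<open>X\<close>, all points
  of \<open>X\<close> would be best approximations, hence equivalent. So all constants are in \<open>X\<close>. If all points
  of period \<open>N\<close> are in \<open>X\<close>, so are those of period \<open>2N\<close>, by induction on the number of positions with
  \<open>z i \<noteq> z (i + N)\<close>: at such a position \<open>r\<close>, overwriting \<open>z r\<close> by \<open>z (r + N)\<close> or \<open>z (r + N)\<close> by
  \<open>z r\<close> (periodically) gives two inequivalent points of \<open>X\<close> at the minimal distance \<open>1/(2N)\<close> from
  \<open>z\<close>, unless \<open>z \<in> X\<close>. Points with period a power of two are dense, and \<open>X\<close> is closed.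
\<close>

section \<open>Counting mismatches\<close>

definition mismatches :: "(int \<Rightarrow> 'a) \<Rightarrow> (int \<Rightarrow> 'a) \<Rightarrow> int \<Rightarrow> int \<Rightarrow> nat" where
  "mismatches x y a b = card {i \<in> {a..b}. x i \<noteq> y i}"

definition translate :: "int \<Rightarrow> (int \<Rightarrow> 'a) \<Rightarrow> int \<Rightarrow> 'a" where
  "translate c x = (\<lambda>i. x (i + c))"

definition periodic :: "nat \<Rightarrow> (int \<Rightarrow> 'a) \<Rightarrow> bool" where
  "periodic N z \<longleftrightarrow> (\<forall>i. z (i + int N) = z i)"

lemma finite_int_interval_Collect [simp]: "finite {i::int. a \<le> i \<and> i \<le> b \<and> P i}"
  by (rule finite_subset[of _ "{a..b}"]) auto

lemma hamming_window: "hamming (window x a b) (window y a b) = mismatches x y a b"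
proof -
  have "bij_betw (\<lambda>k. a + int k)
      {k. k < length (window x a b) \<and> window x a b ! k \<noteq> window y a b ! k}
      {i \<in> {a..b}. x i \<noteq> y i}"
    by (rule bij_betw_byWitness[where f' = "\<lambda>i. nat (i - a)"]) (auto simp: window_def)
  then show ?thesis
    unfolding hamming_def mismatches_def by (rule bij_betw_same_card)
qed

lemma mismatches_commute: "mismatches x y a b = mismatches y x a b"
  by (simp add: mismatches_def eq_commute)

lemma mismatches_triangle: "mismatches x z a b \<le> mismatches x y a b + mismatches y z a b"
proof -
  have "mismatches x z a b \<le> card ({i \<in> {a..b}. x i \<noteq> y i} \<union> {i \<in> {a..b}. y i \<noteq> z i})"
    unfolding mismatches_def by (rule card_mono) auto
  also have "\<dots> \<le> mismatches x y a b + mismatches y z a b"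
    unfolding mismatches_def by (rule card_Un_le)
  finally show ?thesis .
qed

lemma mismatches_le: "mismatches x y a b \<le> nat (b - a + 1)"
proof -
  have "mismatches x y a b \<le> card {a..b}"
    unfolding mismatches_def by (rule card_mono) auto
  then show ?thesis by (simp add: algebra_simps)
qed

lemma mismatches_translate:
  "mismatches (translate c x) (translate c y) a b = mismatches x y (a + c) (b + c)"
proof -
  have "bij_betw (\<lambda>i. i + c) {i \<in> {a..b}. translate c x i \<noteq> translate c y i}
      {i \<in> {a + c..b + c}. x i \<noteq> y i}"
    by (rule bij_betw_byWitness[where f' = "\<lambda>i. i - c"]) (auto simp: translate_def)
  then show ?thesis
    unfolding mismatches_def by (rule bij_betw_same_card)
qed

lemma mismatches_shift_right_le:
  "mismatches x y (a + int k) (b + int k) \<le> mismatches x y a b + k"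
proof -
  have "mismatches x y (a + int k) (b + int k) \<le> card ({i \<in> {a..b}. x i \<noteq> y i} \<union> {b<..b + int k})"
    unfolding mismatches_def by (rule card_mono) auto
  also have "\<dots> \<le> mismatches x y a b + k"
    unfolding mismatches_def by (rule order_trans[OF card_Un_le]) simp
  finally show ?thesis .
qed

lemma mismatches_shift_right_ge:
  "mismatches x y a b \<le> mismatches x y (a + int k) (b + int k) + k"
proof -
  have "mismatches x y a b \<le> card ({i \<in> {a + int k..b + int k}. x i \<noteq> y i} \<union> {a..<a + int k})"
    unfolding mismatches_def by (rule card_mono) auto
  also have "\<dots> \<le> mismatches x y (a + int k) (b + int k) + k"
    unfolding mismatches_def by (rule order_trans[OF card_Un_le]) simp
  finally show ?thesis .
qed

text \<open>Double counting of the pairs \<open>(i, j)\<close> with a mismatch at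
  \<open>i + j\<close>: summed over \<open>i\<close> first, each \<open>j\<close> gives a shifted
  window; summed over \<open>j\<close> first, each \<open>i\<close> gives a block of length
  \<open>N\<close>.\<close>

lemma sum_mismatches_shift:
  "(\<Sum>j<N. mismatches x y (a + int j) (b + int j))
     = (\<Sum>i\<in>{a..b}. card {j. j < N \<and> x (i + int j) \<noteq> y (i + int j)})"
proof -
  have "mismatches x y (a + int j) (b + int j)
      = (\<Sum>i\<in>{a..b}. if x (i + int j) \<noteq> y (i + int j) then 1 else 0)" for j
  proof -
    have "mismatches x y (a + int j) (b + int j)
        = mismatches (translate (int j) x) (translate (int j) y) a b"
      by (simp add: mismatches_translate)
    also have "\<dots> = card ({a..b} \<inter> {i. x (i + int j) \<noteq> y (i + int j)})"
      unfolding mismatches_def translate_def by (rule arg_cong[where f = card]) auto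
    also have "\<dots> = (\<Sum>i\<in>{a..b}. if x (i + int j) \<noteq> y (i + int j) then 1 else 0)"
      by (simp add: sum.If_cases)
    finally show ?thesis .
  qed
  moreover have "card {j. j < N \<and> x (i + int j) \<noteq> y (i + int j)}
      = (\<Sum>j<N. if x (i + int j) \<noteq> y (i + int j) then 1 else 0)" for i
  proof -
    have "{j. j < N \<and> x (i + int j) \<noteq> y (i + int j)}
        = {..<N} \<inter> {j. x (i + int j) \<noteq> y (i + int j)}"
      by auto
    then show ?thesis by (simp add: sum.If_cases)
  qed
  ultimately show ?thesis by (simp add: sum.swap[of _ "{a..b}"])
qed

text \<open>Away from the ends of the window, each mismatch is seen by \<open>N\<close> blocks. Each
  of the \<open>N\<close> shifts moves the window by less than \<open>N\<close>, which accounts for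
  the error \<open>N * N\<close>, here and in the reverse bound.\<close>

lemma sum_block_mismatches_le:
  "(\<Sum>i\<in>{a..b}. card {j. j < N \<and> x (i + int j) \<noteq> y (i + int j)}) \<le> N * mismatches x y a b + N * N"
proof -
  have "(\<Sum>j<N. mismatches x y (a + int j) (b + int j)) \<le> (\<Sum>j<N. mismatches x y a b + N)"
  proof (rule sum_mono)
    fix j assume "j \<in> {..<N}"
    then show "mismatches x y (a + int j) (b + int j) \<le> mismatches x y a b + N"
      using mismatches_shift_right_le[of x y a j b] by simp
  qed
  then show ?thesis by (simp add: sum_mismatches_shift algebra_simps)
qed

lemma sum_block_mismatches_ge:
  "N * mismatches x y a b \<le> (\<Sum>i\<in>{a..b}. card {j. j < N \<and> x (i + int j) \<noteq> y (i + int j)}) + N * N"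
proof -
  have "(\<Sum>j<N. mismatches x y a b) \<le> (\<Sum>j<N. mismatches x y (a + int j) (b + int j) + N)"
  proof (rule sum_mono)
    fix j assume "j \<in> {..<N}"
    then show "mismatches x y a b \<le> mismatches x y (a + int j) (b + int j) + N"
      using mismatches_shift_right_ge[of x y a b j] by simp
  qed
  then show ?thesis by (simp add: sum_mismatches_shift sum.distrib)
qed

section \<open>Besicovitch and Weyl pseudometrics in one family\<close>

definition window_density :: "nat \<Rightarrow> (int \<Rightarrow> 'a) \<Rightarrow> (int \<Rightarrow> 'a) \<Rightarrow> int \<Rightarrow> real" where
  "window_density n x y m = real (mismatches x y (m - int n) (m + int n)) / real (2 * n + 1)"

definition max_density :: "int set \<Rightarrow> nat \<Rightarrow> (int \<Rightarrow> 'a) \<Rightarrow> (int \<Rightarrow> 'a) \<Rightarrow> real" where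
  "max_density S n x y = (MAX m\<in>S. window_density n x y m)"

text \<open>\<open>S\<close> is the set of admissible window centres, so that \<open>{0}\<close>
  gives Besicovitch, \<open>UNIV\<close> gives Weyl, and both are treated at once. The maximum
  exists even for infinite \<open>S\<close>, since the densities for fixed \<open>n\<close> take
  finitely many values.\<close>

definition pseudodist :: "int set \<Rightarrow> (int \<Rightarrow> 'a) \<Rightarrow> (int \<Rightarrow> 'a) \<Rightarrow> ereal" where
  "pseudodist S x y = limsup (\<lambda>n. ereal (max_density S n x y))"

lemma besicovitch_eq_pseudodist: "besicovitch = pseudodist {0}"
  by (intro ext)
    (simp add: besicovitch_def pseudodist_def max_density_def window_density_def hamming_window)

lemma weyl_eq_pseudodist: "weyl = pseudodist UNIV"
  by (intro ext)
    (simp add: weyl_def pseudodist_def max_density_def window_density_def hamming_window)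

lemma finite_window_densities: "finite (window_density n x y ` S)"
proof (rule finite_subset)
  show "window_density n x y ` S \<subseteq> range (window_density n x y)" by auto
  show "finite (range (window_density n x y))"
    using finite_range_window_density[of x n y] by (simp add: window_density_def[abs_def] hamming_window)
qed

lemma max_density_ge: "m \<in> S \<Longrightarrow> window_density n x y m \<le> max_density S n x y"
  unfolding max_density_def by (rule Max_ge) (auto intro: finite_window_densities)

lemma max_density_leI:
  assumes "S \<noteq> {}" and "\<And>m. m \<in> S \<Longrightarrow> window_density n x y m \<le> c"
  shows "max_density S n x y \<le> c"
  unfolding max_density_def using assms by (subst Max_le_iff) (auto intro: finite_window_densities)

lemma max_density_nonneg:
  assumes "S \<noteq> {}"
  shows "0 \<le> max_density S n x y"
proof -
  from assms obtain m where "m \<in> S" by auto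
  have "0 \<le> window_density n x y m" by (simp add: window_density_def)
  also have "\<dots> \<le> max_density S n x y" by (rule max_density_ge[OF \<open>m \<in> S\<close>])
  finally show ?thesis .
qed

lemma max_density_commute: "max_density S n x y = max_density S n y x"
  by (simp add: max_density_def window_density_def mismatches_commute)

lemma max_density_triangle:
  assumes "S \<noteq> {}"
  shows "max_density S n x z \<le> max_density S n x y + max_density S n y z"
proof (rule max_density_leI[OF assms])
  fix m assume "m \<in> S"
  have "window_density n x z m \<le> window_density n x y m + window_density n y z m"
    using mismatches_triangle[of x z "m - int n" "m + int n" y]
    by (simp add: window_density_def divide_right_mono flip: add_divide_distrib of_nat_add)
  also have "\<dots> \<le> max_density S n x y + max_density S n y z"
    by (intro add_mono max_density_ge \<open>m \<in> S\<close>)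
  finally show "window_density n x z m \<le> max_density S n x y + max_density S n y z" .
qed

lemma max_density_le_one:
  assumes "S \<noteq> {}"
  shows "max_density S n x y \<le> 1"
proof (rule max_density_leI[OF assms])
  fix m
  have "mismatches x y (m - int n) (m + int n) \<le> 2 * n + 1"
    using mismatches_le[of x y "m - int n" "m + int n"] by (simp add: nat_add_distrib)
  then show "window_density n x y m \<le> 1" by (simp add: window_density_def)
qed

text \<open>\<open>S\<close> need not be invariant under translation, so the same centre is kept:
  moving the window by \<open>k\<close> brings in at most \<open>k\<close> new positions, an error
  that vanishes as \<open>n\<close> grows.\<close>

lemma max_density_translate_le:
  assumes "S \<noteq> {}"
  shows "max_density S n (translate (int k) x) (translate (int k) y)
    \<le> max_density S n x y + real k / real (2 * n + 1)"
proof (rule max_density_leI[OF assms])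
  fix m assume "m \<in> S"
  have "window_density n (translate (int k) x) (translate (int k) y) m
      \<le> window_density n x y m + real k / real (2 * n + 1)"
    using mismatches_shift_right_le[of x y "m - int n" k "m + int n"]
    by (simp add: window_density_def mismatches_translate divide_right_mono
        flip: add_divide_distrib of_nat_add)
  also have "\<dots> \<le> max_density S n x y + real k / real (2 * n + 1)"
    using max_density_ge[OF \<open>m \<in> S\<close>] by simp
  finally show "window_density n (translate (int k) x) (translate (int k) y) m
      \<le> max_density S n x y + real k / real (2 * n + 1)" .
qed

text \<open>Boundary effects and mismatches of density zero enter as the null sequence
  \<open>e\<close>, and this lemma discards them in the limit.\<close>

lemma limsup_le_limsup_of_le_add_null:
  fixes f g e :: "nat \<Rightarrow> real"
  assumes "\<And>n. f n \<le> g n + e n" and "e \<longlonglongrightarrow> 0"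
  shows "limsup (\<lambda>n. ereal (f n)) \<le> limsup (\<lambda>n. ereal (g n))"
proof -
  have "limsup (\<lambda>n. ereal (f n)) \<le> limsup (\<lambda>n. ereal (e n) + ereal (g n))"
    by (rule Limsup_mono) (use assms(1) in \<open>simp add: add.commute\<close>)
  also have "\<dots> = 0 + limsup (\<lambda>n. ereal (g n))"
    by (rule ereal_limsup_lim_add) (use assms(2) in \<open>auto simp: zero_ereal_def\<close>)
  finally show ?thesis by simp
qed

lemma const_over_odd_tendsto_0: "(\<lambda>n. c / real (2 * n + 1)) \<longlonglongrightarrow> 0"
proof (rule real_tendsto_divide_at_top[OF tendsto_const])
  show "filterlim (\<lambda>n. real (2 * n + 1)) at_top sequentially"
    by (rule filterlim_compose[OF filterlim_real_sequentially])
      (auto intro!: filterlim_subseq strict_monoI)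
qed

lemma pseudodist_le_one:
  assumes "S \<noteq> {}"
  shows "pseudodist S x y \<le> 1"
proof -
  have "limsup (\<lambda>n. ereal (max_density S n x y)) \<le> limsup (\<lambda>n. ereal 1)"
    by (rule Limsup_mono) (simp add: max_density_le_one assms)
  then show ?thesis by (simp add: pseudodist_def Limsup_const one_ereal_def)
qed

lemma pseudodist_commute: "pseudodist S x y = pseudodist S y x"
  by (simp add: pseudodist_def max_density_commute)

text \<open>The densities are nonnegative, so a zero limit superior is a limit. This lets the
  density between equivalent points serve as a null sequence.\<close>

lemma pseudodist_eq_0_imp_tendsto:
  assumes "S \<noteq> {}" and "pseudodist S x y = 0"
  shows "(\<lambda>n. max_density S n x y) \<longlonglongrightarrow> 0"
proof -
  have "(\<lambda>n. ereal (max_density S n x y)) \<longlonglongrightarrow> 0"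
  proof (rule Liminf_eq_Limsup)
    show limsup: "limsup (\<lambda>n. ereal (max_density S n x y)) = 0"
      using assms(2) by (simp add: pseudodist_def)
    have "0 \<le> liminf (\<lambda>n. ereal (max_density S n x y))"
      by (rule Liminf_bounded) (simp add: max_density_nonneg assms)
    then show "liminf (\<lambda>n. ereal (max_density S n x y)) = 0"
      using Liminf_le_Limsup[of sequentially "\<lambda>n. ereal (max_density S n x y)"] limsup by simp
  qed simp
  then show ?thesis by (simp add: zero_ereal_def)
qed

lemma pseudodist_nonneg: "S \<noteq> {} \<Longrightarrow> 0 \<le> pseudodist S x y"
  unfolding pseudodist_def
  by (rule le_Limsup) (auto simp: max_density_nonneg)

lemma pseudodist_trans_null:
  assumes "S \<noteq> {}" and "pseudodist S x y = 0" and "pseudodist S y z = 0"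
  shows "pseudodist S x z = 0"
proof (rule antisym)
  have "pseudodist S x z \<le> pseudodist S y z"
    unfolding pseudodist_def
  proof (rule limsup_le_limsup_of_le_add_null)
    show "max_density S n x z \<le> max_density S n y z + max_density S n x y" for n
      using max_density_triangle[OF assms(1), of n x z y] by simp
  qed (rule pseudodist_eq_0_imp_tendsto[OF assms(1,2)])
  then show "pseudodist S x z \<le> 0" by (simp add: assms(3))
qed (rule pseudodist_nonneg[OF assms(1)])

lemma pseudodist_translate_le:
  assumes "S \<noteq> {}"
  shows "pseudodist S (translate (int k) x) (translate (int k) y) \<le> pseudodist S x y"
  unfolding pseudodist_def
  by (rule limsup_le_limsup_of_le_add_null[OF max_density_translate_le[OF assms]
      const_over_odd_tendsto_0])

text \<open>Averaging over all blocks of length \<open>N\<close>: each of the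
  \<open>2 * n + 1\<close> blocks starting in a window has at most one mismatch, while each mismatch
  is counted \<open>N\<close> times up to the boundary error.\<close>

lemma pseudodist_le_inverse:
  fixes x y :: "int \<Rightarrow> 'a" and N :: nat
  assumes "S \<noteq> {}" and "N > 0"
    and one: "\<And>i. card {j. j < N \<and> x (i + int j) \<noteq> y (i + int j)} \<le> 1"
  shows "pseudodist S x y \<le> ereal (1 / N)"
proof -
  have "max_density S n x y \<le> 1 / N + real N / real (2 * n + 1)" for n
  proof (rule max_density_leI[OF assms(1)])
    fix m
    let ?M = "mismatches x y (m - int n) (m + int n)"
    have "(\<Sum>i\<in>{m - int n..m + int n}. card {j. j < N \<and> x (i + int j) \<noteq> y (i + int j)})
        \<le> (\<Sum>i\<in>{m - int n..m + int n}. 1)"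
      by (rule sum_mono) (rule one)
    also have "\<dots> = 2 * n + 1" by (simp add: nat_add_distrib)
    finally have "N * ?M \<le> 2 * n + 1 + N * N"
      using sum_block_mismatches_ge[of N x y "m - int n" "m + int n"] by linarith
    then have "real (N * ?M) / (real N * real (2 * n + 1))
        \<le> real (2 * n + 1 + N * N) / (real N * real (2 * n + 1))"
      by (intro divide_right_mono of_nat_mono) auto
    moreover have "N * M / (N * w) = M / w \<and> (w + N * N) / (N * w) = 1 / N + N / w"
      if "N > 0" "w > 0" for N M w :: real
      using that by (simp add: divide_simps)
    from this[of "real N" "real (2 * n + 1)" "real ?M"]
    have "real (N * ?M) / (real N * real (2 * n + 1)) = window_density n x y m"
      and "real (2 * n + 1 + N * N) / (real N * real (2 * n + 1)) = 1 / N + real N / real (2 * n + 1)"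
      using \<open>N > 0\<close> by (simp_all add: window_density_def add.assoc)
    ultimately show "window_density n x y m \<le> 1 / N + real N / real (2 * n + 1)"
      by metis
  qed
  then have "pseudodist S x y \<le> limsup (\<lambda>n. ereal (1 / N))"
    unfolding pseudodist_def
    by (rule limsup_le_limsup_of_le_add_null) (rule const_over_odd_tendsto_0)
  then show ?thesis by (simp add: Limsup_const)
qed

text \<open>The hypothesis \<open>null\<close> says that \<open>x\<close> is
  \<open>N\<close>-periodic up to density zero. Where this periodicity holds for \<open>L\<close>
  steps, the mismatch promised by \<open>long\<close> can be moved into the first \<open>N\<close>
  positions, so almost every block of length \<open>N\<close> contains one.\<close>

lemma pseudodist_ge_inverse:
  fixes x z :: "int \<Rightarrow> 'a" and N :: nat
  assumes "S \<noteq> {}" and "N > 0" and "periodic N z"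
    and null: "pseudodist S x (translate (int N) x) = 0"
    and long: "\<And>i. \<exists>j<L. x (i + int j) \<noteq> z (i + int j)"
  shows "ereal (1 / N) \<le> pseudodist S z x"
proof -
  let ?y = "translate (int N) x"
  from \<open>S \<noteq> {}\<close> obtain m where "m \<in> S" by auto
  \<comment> \<open>If \<open>x\<close> agrees with its translate on the \<open>L\<close> positions
    from \<open>i\<close>, take the first mismatch \<open>j\<close> of \<open>x\<close> and
    \<open>z\<close>. Were \<open>j\<close> at least \<open>N\<close>, going back by
    \<open>N\<close> would change neither value and give an earlier mismatch.\<close>
  have block: "1 \<le> card {j. j < N \<and> z (i + int j) \<noteq> x (i + int j)}
      + card {j. j < L \<and> x (i + int j) \<noteq> ?y (i + int j)}" for i
  proof (cases "{j. j < L \<and> x (i + int j) \<noteq> ?y (i + int j)} = {}")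
    case True
    define j where "j = (LEAST j. x (i + int j) \<noteq> z (i + int j))"
    obtain j' where j': "j' < L" "x (i + int j') \<noteq> z (i + int j')" using long by blast
    have j: "x (i + int j) \<noteq> z (i + int j)"
      unfolding j_def using j'(2) by (rule LeastI)
    have "j \<le> j'" unfolding j_def using j'(2) by (rule Least_le)
    have "j < N"
    proof (rule ccontr)
      assume "\<not> j < N"
      then have eq: "i + int j = (i + int (j - N)) + int N" by simp
      have "j - N < L" using \<open>j \<le> j'\<close> \<open>j' < L\<close> by linarith
      then have "x (i + int (j - N)) = x (i + int j)"
        using True by (auto simp: translate_def eq)
      moreover have "z (i + int j) = z (i + int (j - N))"
        using \<open>periodic N z\<close> unfolding eq periodic_def by blast
      ultimately have "x (i + int (j - N)) \<noteq> z (i + int (j - N))" using j by simp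
      then have "j \<le> j - N" unfolding j_def by (rule Least_le)
      then show False using \<open>N > 0\<close> \<open>\<not> j < N\<close> by simp
    qed
    then have "{j. j < N \<and> z (i + int j) \<noteq> x (i + int j)} \<noteq> {}" using j by auto
    then have "card {j. j < N \<and> z (i + int j) \<noteq> x (i + int j)} > 0" by (subst card_gt_0_iff) auto
    then show ?thesis by simp
  next
    case False
    then have "card {j. j < L \<and> x (i + int j) \<noteq> ?y (i + int j)} > 0" by (subst card_gt_0_iff) auto
    then show ?thesis by simp
  qed
  \<comment> \<open>The error after dividing by \<open>N\<close> times the window length: the blocks
    where periodicity of \<open>x\<close> fails, and the boundary terms from blocks of length
    \<open>N\<close> and \<open>L\<close>.\<close>
  define e where "e n = real L / real N * max_density S n x ?y
      + ((real N * real N + real L * real L) / real N) / real (2 * n + 1)" for n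
  have "1 / N \<le> max_density S n z x + e n" for n
  proof -
    let ?W = "{m - int n..m + int n}"
    let ?M = "mismatches z x (m - int n) (m + int n)"
    let ?B = "mismatches x ?y (m - int n) (m + int n)"
    have "2 * n + 1 = (\<Sum>i\<in>?W. 1)" by (simp add: nat_add_distrib)
    also have "\<dots> \<le> (\<Sum>i\<in>?W. card {j. j < N \<and> z (i + int j) \<noteq> x (i + int j)}
      + card {j. j < L \<and> x (i + int j) \<noteq> ?y (i + int j)})"
      by (rule sum_mono) (rule block)
    also have "\<dots> \<le> (N * ?M + N * N) + (L * ?B + L * L)"
      unfolding sum.distrib by (intro add_mono sum_block_mismatches_le)
    finally have "real (2 * n + 1) / (real N * real (2 * n + 1))
        \<le> real ((N * ?M + N * N) + (L * ?B + L * L)) / (real N * real (2 * n + 1))"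
      by (intro divide_right_mono of_nat_mono) auto
    moreover have "w / (N * w) = 1 / N \<and> (N * M + N * N + (L * B + L * L)) / (N * w)
        = M / w + (L / N * (B / w) + ((N * N + L * L) / N) / w)" if "N > 0" "w > 0"
      for N M L B w :: real
      using that by (simp add: divide_simps)
    from this[of "real N" "real (2 * n + 1)" "real ?M" "real L" "real ?B"]
    have "real (2 * n + 1) / (real N * real (2 * n + 1)) = 1 / real N"
      and "real ((N * ?M + N * N) + (L * ?B + L * L)) / (real N * real (2 * n + 1))
        = window_density n z x m + (real L / real N * window_density n x ?y m
      + ((real N * real N + real L * real L) / real N) / real (2 * n + 1))"
      using \<open>N > 0\<close> by (simp_all add: window_density_def)
    ultimately have "1 / N \<le> window_density n z x m + (real L / real N * window_density n x ?y m
      + ((real N * real N + real L * real L) / real N) / real (2 * n + 1))"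
      by metis
    \<comment> \<open>For a lower bound a single centre \<open>m\<close> of \<open>S\<close>
      suffices, since the maximum dominates its density.\<close>
    also have "\<dots> \<le> max_density S n z x + e n"
      unfolding e_def using max_density_ge[OF \<open>m \<in> S\<close>]
      by (intro add_mono mult_left_mono) auto
    finally show ?thesis .
  qed
  moreover have "e \<longlonglongrightarrow> 0"
    unfolding e_def[abs_def]
    by (rule tendsto_add_zero[OF tendsto_mult_right_zero const_over_odd_tendsto_0])
      (rule pseudodist_eq_0_imp_tendsto[OF assms(1) null])
  ultimately have "limsup (\<lambda>n. ereal (1 / N)) \<le> pseudodist S z x"
    unfolding pseudodist_def by (rule limsup_le_limsup_of_le_add_null)
  then show ?thesis by (simp add: Limsup_const)
qed

section \<open>Periodic points and subshifts\<close>

lemma periodic_mult: "periodic N z \<Longrightarrow> z (i + k * int N) = z i"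
proof (induction k rule: int_induct[where k = 0])
  case (step1 k)
  have "z (i + (k + 1) * int N) = z ((i + k * int N) + int N)" by (simp add: algebra_simps)
  then show ?case using step1 by (simp add: periodic_def)
next
  case (step2 k)
  have "z (i + k * int N) = z ((i + (k - 1) * int N) + int N)" by (simp add: algebra_simps)
  then show ?case using step2 by (simp add: periodic_def)
qed simp

lemma periodic_mod: "periodic N z \<Longrightarrow> z (i mod int N) = z i"
  using periodic_mult[of N z "i mod int N" "i div int N"] by simp

lemma subshift_translate:
  assumes "subshift X" and "x \<in> X"
  shows "translate c x \<in> X"
proof (induction c rule: int_induct[where k = 0])
  case base
  show ?case using assms(2) by (simp add: translate_def)
next
  case (step1 c)
  have "translate (c + 1) x = shift (translate c x)"
    by (simp add: translate_def shift_def algebra_simps)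
  then show ?case using step1 assms(1) by (auto simp: subshift_def)
next
  case (step2 c)
  then obtain y where y: "y \<in> X" "translate c x = shift y"
    using assms(1) unfolding subshift_def by blast
  have "y = translate (c - 1) x"
  proof
    fix i
    show "y i = translate (c - 1) x i"
      using fun_cong[OF y(2), of "i - 1"] by (simp add: translate_def shift_def algebra_simps)
  qed
  then show ?case using y(1) by simp
qed

text \<open>The complement of \<open>X\<close> is open, so some cylinder around \<open>z\<close>
  misses \<open>X\<close>. It restricts finitely many coordinates, all of which lie in one symmetric
  interval.\<close>

lemma subshift_separation:
  assumes "subshift X" and "z \<notin> X"
  obtains n :: nat where "\<And>x. x \<in> X \<Longrightarrow> \<exists>i\<in>{- int n..int n}. x i \<noteq> z i"
proof -
  let ?T = "\<lambda>_::int. discrete_topology (UNIV :: 'a set)"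
  have "openin (product_topology ?T UNIV) (UNIV - X)"
    using assms(1) by (simp add: subshift_def full_shift_topology_def closedin_def)
  then have "\<exists>U. finite {i. U i \<noteq> UNIV} \<and> z \<in> (\<Pi>\<^sub>E i\<in>UNIV. U i) \<and> (\<Pi>\<^sub>E i\<in>UNIV. U i) \<subseteq> UNIV - X"
    using assms(2) unfolding openin_product_topology_alt by auto
  then obtain U where U: "finite {i. U i \<noteq> UNIV}" "z \<in> (\<Pi>\<^sub>E i\<in>UNIV. U i)"
      "(\<Pi>\<^sub>E i\<in>UNIV. U i) \<subseteq> UNIV - X"
    by blast
  let ?F = "{i. U i \<noteq> UNIV}"
  \<comment> \<open>The inserted 0 keeps the set nonempty when no coordinate is restricted.\<close>
  define n where "n = Max (insert 0 ((\<lambda>i. nat \<bar>i\<bar>) ` ?F))"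
  have n: "i \<in> {- int n..int n}" if "i \<in> ?F" for i
  proof -
    have "nat \<bar>i\<bar> \<le> n" unfolding n_def by (rule Max_ge) (use U(1) that in auto)
    then show ?thesis by auto
  qed
  show thesis
  proof (rule that[of n], rule ccontr)
    fix x assume "x \<in> X" and "\<not> (\<exists>i\<in>{- int n..int n}. x i \<noteq> z i)"
    then have "x i \<in> U i" for i
      using n[of i] U(2) by (cases "i \<in> ?F") (auto simp: PiE_iff)
    then show False using U(3) \<open>x \<in> X\<close> by auto
  qed
qed

text \<open>Separation at the origin carries over to every translate of the interval by a multiple
  of \<open>N\<close>: \<open>X\<close> is invariant under the translation and \<open>z\<close> is
  unchanged by it. Every sufficiently long interval contains such a translate.\<close>

lemma subshift_periodic_long_mismatch:
  assumes "subshift X" and "z \<notin> X" and "periodic N z" and "N > 0"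
  obtains L where "\<And>x i. x \<in> X \<Longrightarrow> \<exists>j<L. x (i + int j) \<noteq> z (i + int j)"
proof -
  obtain n :: nat where n: "\<And>x. x \<in> X \<Longrightarrow> \<exists>i\<in>{- int n..int n}. x i \<noteq> z i"
    using subshift_separation[OF assms(1,2)] by blast
  show thesis
  proof (rule that[of "2 * n + N + 1"])
    fix x i assume "x \<in> X"
    \<comment> \<open>With this \<open>k\<close>, the interval of radius \<open>n\<close> around
      \<open>k * int N\<close> lies between \<open>i\<close> and
      \<open>i + 2 * n + N\<close>.\<close>
    define k where "k = (i + int n) div int N + 1"
    have "k * int N = i + int n + int N - (i + int n) mod int N"
      unfolding k_def by (simp add: algebra_simps minus_mod_eq_mult_div[symmetric])
    moreover have "0 \<le> (i + int n) mod int N" "(i + int n) mod int N < int N"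
      using assms(4) by auto
    ultimately have k: "i + int n \<le> k * int N" "k * int N \<le> i + int n + int N" by auto
    obtain l where l: "l \<in> {- int n..int n}" "x (l + k * int N) \<noteq> z l"
      using n[OF subshift_translate[OF assms(1) \<open>x \<in> X\<close>, of "k * int N"]]
      by (auto simp: translate_def)
    have "z (l + k * int N) = z l" by (rule periodic_mult[OF assms(3)])
    then show "\<exists>j<2 * n + N + 1. x (i + int j) \<noteq> z (i + int j)"
      using l k by (intro exI[of _ "nat (l + k * int N - i)"]) auto
  qed
qed

lemma subshift_eq_UNIV_of_periodic:
  assumes "subshift X" and "\<And>k z. periodic (2 ^ k) z \<Longrightarrow> z \<in> X"
  shows "X = UNIV"
proof (rule ccontr)
  assume "X \<noteq> UNIV"
  then obtain z where "z \<notin> X" by auto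
  then obtain n :: nat where n: "\<And>x. x \<in> X \<Longrightarrow> \<exists>i\<in>{- int n..int n}. x i \<noteq> z i"
    using subshift_separation[OF assms(1)] by blast
  let ?N = "2 ^ (2 * n + 1) :: nat"
  \<comment> \<open>The block of \<open>z\<close> of length \<open>?N\<close> starting at
    \<open>- int n\<close>, repeated periodically; it is long enough to cover the separating
    interval.\<close>
  define x where "x i = z ((i + int n) mod int ?N - int n)" for i
  have "periodic ?N x"
    unfolding periodic_def
  proof
    fix i
    have "i + int ?N + int n = (i + int n) + int ?N" by (simp only: ac_simps)
    then show "x (i + int ?N) = x i" by (simp only: x_def mod_add_self2)
  qed
  then have "x \<in> X" by (rule assms(2))
  moreover have "x i = z i" if "i \<in> {- int n..int n}" for i
  proof -
    have "2 * n + 1 < ?N" by (rule less_exp)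
    then have "2 * int n + 1 < int ?N" by linarith
    then have "(i + int n) mod int ?N = i + int n"
      using that by (intro mod_pos_pos_trivial) auto
    then show ?thesis by (simp add: x_def)
  qed
  ultimately show False using n by blast
qed

section \<open>Consequences of unique approximation\<close>

text \<open>Uniqueness makes a best approximation \<open>x0\<close> equivalent to its translate by
  \<open>N\<close>, which is what \<open>pseudodist_ge_inverse\<close> needs. The bound for
  \<open>x0\<close> passes to every \<open>x\<close> in \<open>X\<close> by minimality.\<close>

lemma periodic_dist_ge_inverse:
  assumes "S \<noteq> {}" and "subshift X" and uap: "unique_approximation_property (pseudodist S) X"
    and "z \<notin> X" and "periodic N z" and "N > 0" and "x \<in> X"
  shows "ereal (1 / N) \<le> pseudodist S z x"
proof -
  let ?d = "pseudodist S"
  obtain x0 where x0: "x0 \<in> best_approx ?d z X"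
    using uap unfolding unique_approximation_property_def by blast
  then have "x0 \<in> X" and dx0: "?d z x0 = dist_to_set ?d z X" by (auto simp: best_approx_def)
  have dist_le: "dist_to_set ?d z X \<le> ?d z y" if "y \<in> X" for y
    unfolding dist_to_set_def using that by (rule INF_lower)
  let ?x1 = "translate (int N) x0"
  have "?x1 \<in> X" by (rule subshift_translate[OF assms(2) \<open>x0 \<in> X\<close>])
  have "translate (int N) z = z" using assms(5) by (auto simp: translate_def periodic_def)
  then have "?d z ?x1 \<le> ?d z x0" using pseudodist_translate_le[OF assms(1), of N z x0] by simp
  then have "?x1 \<in> best_approx ?d z X"
    using \<open>?x1 \<in> X\<close> dist_le[OF \<open>?x1 \<in> X\<close>] dx0 by (simp add: best_approx_def)
  then have "?d x0 ?x1 = 0"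
    using uap x0 unfolding unique_approximation_property_def null_rel_def by blast
  moreover obtain L where "\<And>x i. x \<in> X \<Longrightarrow> \<exists>j<L. x (i + int j) \<noteq> z (i + int j)"
    using subshift_periodic_long_mismatch[OF assms(2,4,5,6)] by blast
  ultimately have "ereal (1 / N) \<le> ?d z x0"
    using \<open>x0 \<in> X\<close> by (intro pseudodist_ge_inverse[OF assms(1,6,5)])
  also have "\<dots> \<le> ?d z x" using dist_le[OF \<open>x \<in> X\<close>] dx0 by simp
  finally show ?thesis .
qed

text \<open>As \<open>1 / N\<close> is a lower bound for the distance from \<open>z\<close> to
  \<open>X\<close>, every point of \<open>X\<close> within \<open>1 / N\<close> of \<open>z\<close>
  is a best approximation.\<close>

lemma equivalent_of_dist_eq_inverse:
  assumes "S \<noteq> {}" and "subshift X" and uap: "unique_approximation_property (pseudodist S) X"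
    and "z \<notin> X" and "periodic N z" and "N > 0"
    and "x \<in> X" and "pseudodist S z x \<le> ereal (1 / N)"
    and "y \<in> X" and "pseudodist S z y \<le> ereal (1 / N)"
  shows "pseudodist S x y = 0"
proof -
  let ?d = "pseudodist S"
  have "v \<in> best_approx ?d z X" if "v \<in> X" "?d z v \<le> ereal (1 / N)" for v
  proof -
    have "ereal (1 / N) \<le> dist_to_set ?d z X"
      unfolding dist_to_set_def
      by (rule INF_greatest) (rule periodic_dist_ge_inverse[OF assms(1-6)])
    moreover have "dist_to_set ?d z X \<le> ?d z v"
      unfolding dist_to_set_def using that(1) by (rule INF_lower)
    ultimately show ?thesis using that by (simp add: best_approx_def)
  qed
  then show ?thesis
    using assms(7-10) uap unfolding unique_approximation_property_def null_rel_def by blast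
qed

section \<open>Residue classes and exactly periodic points\<close>

lemma card_block_residue_le_one:
  assumes "\<And>i. P i \<Longrightarrow> i mod int N = r"
  shows "card {j. j < N \<and> P (i + int j)} \<le> 1"
proof -
  have "j = k" if jk: "j < N" "k < N" "P (i + int j)" "P (i + int k)" for j k
  proof -
    have "(i + int j) mod int N = (i + int k) mod int N" using assms jk by metis
    then have "int j mod int N = int k mod int N"
      by (metis add_diff_cancel_left' mod_diff_left_eq)
    then show ?thesis using jk by simp
  qed
  then have "\<exists>j. {j. j < N \<and> P (i + int j)} \<subseteq> {j}" by blast
  then show ?thesis by (metis card_1_singleton_iff card_mono finite.emptyI finite.insertI One_nat_def)
qed

text \<open>A difference at \<open>r\<close> recurs along its residue class modulo \<open>N\<close>,
  hence in every block of length \<open>N\<close>, so \<open>pseudodist_ge_inverse\<close> with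
  \<open>L = N\<close> gives a positive distance.\<close>

lemma equivalent_periodic_eq:
  assumes "S \<noteq> {}" and "N > 0" and "periodic N x" and "periodic N y" and "pseudodist S x y = 0"
  shows "x = y"
proof (rule ccontr)
  assume "x \<noteq> y"
  then obtain r where r: "x r \<noteq> y r" by auto
  have "\<exists>j<N. x (i + int j) \<noteq> y (i + int j)" for i
  proof (intro exI conjI)
    let ?j = "nat ((r - i) mod int N)"
    show "?j < N" using assms(2) by (simp add: nat_less_iff)
    have "(i + int ?j) mod int N = r mod int N"
      using assms(2) by (simp add: mod_add_right_eq)
    then show "x (i + int ?j) \<noteq> y (i + int ?j)"
      using r periodic_mod[OF assms(3)] periodic_mod[OF assms(4)] by metis
  qed
  moreover have "translate (int N) x = x" using assms(3) by (auto simp: translate_def periodic_def)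
  \<comment> \<open>Reflexivity is obtained by going from \<open>x\<close> to \<open>y\<close> and
    back; with exact periodicity it gives the null hypothesis of the lower bound.\<close>
  moreover have "pseudodist S x x = 0"
    using pseudodist_trans_null[OF assms(1,5)] assms(5) by (simp add: pseudodist_commute)
  ultimately have "ereal (1 / N) \<le> pseudodist S y x"
    by (intro pseudodist_ge_inverse[OF assms(1,2,4)]) auto
  then show False
    using assms(2,5) by (simp add: pseudodist_commute[of S y x] zero_ereal_def)
qed

text \<open>For \<open>N = 1\<close> the threshold \<open>1 / N\<close> is the trivial upper bound
  for the pseudodistance, so every point of \<open>X\<close> meets it.\<close>

lemma constant_in_subshift:
  assumes "S \<noteq> {}" and "subshift X" and "unique_approximation_property (pseudodist S) X"
    and two: "\<exists>C \<in> saturation (pseudodist S) X // null_rel (pseudodist S).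
      \<exists>D \<in> saturation (pseudodist S) X // null_rel (pseudodist S). C \<noteq> D"
    and "periodic 1 z"
  shows "z \<in> X"
proof (rule ccontr)
  assume "z \<notin> X"
  let ?d = "pseudodist S"
  have null: "?d x y = 0" if "x \<in> X" "y \<in> X" for x y
    by (rule equivalent_of_dist_eq_inverse[OF assms(1-3) \<open>z \<notin> X\<close> assms(5)])
      (use that pseudodist_le_one[OF assms(1), of z] in \<open>auto simp: one_ereal_def\<close>)
  note trans = pseudodist_trans_null[OF assms(1)]
  \<comment> \<open>Equivalence of all points of \<open>X\<close> spreads to the saturation by
    transitivity, leaving at most one class there.\<close>
  have "?d y y' = 0" if "y \<in> saturation ?d X" "y' \<in> saturation ?d X" for y y'
  proof -
    obtain x x' where "x \<in> X" "?d x y = 0" "x' \<in> X" "?d x' y' = 0"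
      using \<open>y \<in> saturation ?d X\<close> \<open>y' \<in> saturation ?d X\<close>
      by (auto simp: saturation_def null_rel_def)
    then show ?thesis
      using trans null pseudodist_commute by metis
  qed
  then have "null_rel ?d `` {y} = null_rel ?d `` {y'}"
    if "y \<in> saturation ?d X" "y' \<in> saturation ?d X" for y y'
    using that trans pseudodist_commute unfolding null_rel_def by blast
  then show False using two unfolding quotient_def by blast
qed

section \<open>Doubling the period\<close>

definition copy_from_half_period :: "nat \<Rightarrow> int \<Rightarrow> (int \<Rightarrow> 'a) \<Rightarrow> int \<Rightarrow> 'a" where
  "copy_from_half_period N r z =
     (\<lambda>i. if i mod int (2 * N) = r mod int (2 * N) then z (i + int N) else z i)"

lemma add_half_period_mod_neq:
  assumes "N > 0"
  shows "(i + int N) mod int (2 * N) \<noteq> i mod int (2 * N)"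
proof
  assume "(i + int N) mod int (2 * N) = i mod int (2 * N)"
  then have "int (2 * N) dvd (i + int N) - i" by (simp only: mod_eq_dvd_iff)
  then have "2 * N dvd N" by (simp only: add_diff_cancel_left' int_dvd_int_iff)
  then show False using assms by (auto dest: dvd_imp_le)
qed

lemma double_period_in_subshift:
  assumes "S \<noteq> {}" and "subshift X" and "unique_approximation_property (pseudodist S) X"
    and "N > 0" and half: "\<And>z. periodic N z \<Longrightarrow> z \<in> X" and "periodic (2 * N) z"
  shows "z \<in> X"
  using assms(6)
\<comment> \<open>The measure counts, within one period of length \<open>2 * N\<close>, the
  positions where \<open>z\<close> fails to be \<open>N\<close>-periodic.\<close>
proof (induction "card {i \<in> {0..<int (2 * N)}. z i \<noteq> z (i + int N)}" arbitrary: z rule: less_induct)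
  case less
  let ?M = "int (2 * N)"
  have M: "?M > 0" using assms(4) by simp
  have modM: "z (i mod ?M) = z i" for i by (rule periodic_mod[OF less.prems])
  have per2: "z (i + int N + int N) = z i" for i
    using less.prems by (simp add: periodic_def add.assoc)
  show ?case
  proof (cases "periodic N z")
    case False
    then obtain r where r: "z (r + int N) \<noteq> z r" by (auto simp: periodic_def)
    have neighbour: "copy_from_half_period N s z \<in> X" "periodic (2 * N) (copy_from_half_period N s z)"
        "pseudodist S z (copy_from_half_period N s z) \<le> ereal (1 / real (2 * N))"
      if s: "z s \<noteq> z (s + int N)" for s
    proof -
      define y where "y = copy_from_half_period N s z"
      have y: "y i = (if i mod ?M = s mod ?M then z (i + int N) else z i)" for i
        by (simp add: y_def copy_from_half_period_def)
      show per: "periodic (2 * N) (copy_from_half_period N s z)"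
        unfolding y_def[symmetric] periodic_def
      proof
        fix i
        have z: "z (k + ?M) = z k" for k using less.prems unfolding periodic_def by blast
        have "i + ?M + int N = (i + int N) + ?M" by (simp only: ac_simps)
        then show "y (i + ?M) = y i" by (simp only: y mod_add_self2 z)
      qed
      \<comment> \<open>Overwriting creates no new defect and repairs those at the residues of
        \<open>s\<close> and \<open>s + int N\<close>, so the measure drops.\<close>
      have y_half: "y i = y (i + int N) \<longleftrightarrow> z i = z (i + int N) \<or> i mod ?M = s mod ?M
          \<or> (i + int N) mod ?M = s mod ?M" for i
        using add_half_period_mod_neq[OF assms(4), of i] per2[of i] by (auto simp: y)
      have sM: "z (s mod ?M + int N) = z (s + int N)"
        using modM[of "s mod ?M + int N"] modM[of "s + int N"] by (simp only: mod_add_left_eq)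
      have "{i \<in> {0..<?M}. y i \<noteq> y (i + int N)} \<subset> {i \<in> {0..<?M}. z i \<noteq> z (i + int N)}"
      proof (rule psubsetI)
        show "{i \<in> {0..<?M}. y i \<noteq> y (i + int N)} \<subseteq> {i \<in> {0..<?M}. z i \<noteq> z (i + int N)}"
          unfolding y_half by auto
        have "s mod ?M \<in> {i \<in> {0..<?M}. z i \<noteq> z (i + int N)}"
          using s M sM modM[of s] by (simp del: of_nat_mult)
        moreover have "s mod ?M \<notin> {i \<in> {0..<?M}. y i \<noteq> y (i + int N)}"
          by (simp add: y_half del: of_nat_mult)
        ultimately show "{i \<in> {0..<?M}. y i \<noteq> y (i + int N)} \<noteq> {i \<in> {0..<?M}. z i \<noteq> z (i + int N)}"
          by blast
      qed
      then have "card {i \<in> {0..<?M}. y i \<noteq> y (i + int N)} < card {i \<in> {0..<?M}. z i \<noteq> z (i + int N)}"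
        by (rule psubset_card_mono[rotated]) (rule finite_subset[of _ "{0..<?M}"], auto)
      then show "copy_from_half_period N s z \<in> X"
        using less.hyps per unfolding y_def by blast
      \<comment> \<open>All changes lie in one residue class modulo \<open>2 * N\<close>, so each
        block of that length contains at most one.\<close>
      have "i mod ?M = s mod ?M" if "z i \<noteq> y i" for i using that by (auto simp: y split: if_splits)
      then show "pseudodist S z (copy_from_half_period N s z) \<le> ereal (1 / real (2 * N))"
        unfolding y_def[symmetric]
        by (intro pseudodist_le_inverse[OF assms(1)] card_block_residue_le_one) (use assms(4) in auto)
    qed
    \<comment> \<open>The other half of the defect at \<open>r\<close> is also a defect, because
      \<open>z\<close> has period \<open>2 * N\<close>; this supplies the second neighbour.\<close>
    have r': "z (r + int N) \<noteq> z (r + int N + int N)" using r per2 by simp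
    note nb1 = neighbour[OF r[symmetric]] and nb2 = neighbour[OF r']
    show ?thesis
    proof (rule ccontr)
      assume "z \<notin> X"
      have pos: "2 * N > 0" using assms(4) by simp
      have "pseudodist S (copy_from_half_period N r z) (copy_from_half_period N (r + int N) z) = 0"
        by (rule equivalent_of_dist_eq_inverse[OF assms(1-3) \<open>z \<notin> X\<close> less.prems pos
              nb1(1,3) nb2(1,3)])
      then have "copy_from_half_period N r z = copy_from_half_period N (r + int N) z"
        by (rule equivalent_periodic_eq[OF assms(1) pos nb1(2) nb2(2)])
      \<comment> \<open>At \<open>r\<close> the first neighbour has the value
        \<open>z (r + int N)\<close>, while the second, overwritten only on the class of
        \<open>r + int N\<close>, still has \<open>z r\<close>.\<close>
      then have "copy_from_half_period N r z r = copy_from_half_period N (r + int N) z r"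
        by simp
      then show False
        using r add_half_period_mod_neq[OF assms(4), of r]
        by (simp add: copy_from_half_period_def del: of_nat_mult)
    qed
  qed (rule half)
qed

theorem theorem6:
  fixes X :: "(int \<Rightarrow> 'a::finite) set"
    and dG :: "(int \<Rightarrow> 'a) \<Rightarrow> (int \<Rightarrow> 'a) \<Rightarrow> ereal"
  assumes "dG = besicovitch \<or> dG = weyl"
    and "subshift X"
    and "X \<noteq> {}"
    and "unique_approximation_property dG X"
    and "\<exists>C \<in> saturation dG X // null_rel dG. \<exists>D \<in> saturation dG X // null_rel dG. C \<noteq> D"
  shows "X = UNIV"
proof -
  \<comment> \<open>From here on the two pseudometrics are handled together through a nonempty set
    \<open>S\<close> of centres.\<close>
  obtain S where S: "S \<noteq> {}" and dG: "dG = pseudodist S"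
    using assms(1) besicovitch_eq_pseudodist weyl_eq_pseudodist
    by (metis UNIV_not_empty insert_not_empty)
  have "z \<in> X" if "periodic (2 ^ k) z" for k z
    using that
  proof (induction k arbitrary: z)
    case 0
    then show ?case
      using constant_in_subshift[OF S assms(2) assms(4,5)[unfolded dG]] by simp
  next
    case (Suc k)
    show ?case
      by (rule double_period_in_subshift[OF S assms(2) assms(4)[unfolded dG], of "2 ^ k"])
        (use Suc in auto)
  qed
  then show ?thesis by (rule subshift_eq_UNIV_of_periodic[OF assms(2)])
qed

end
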